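(* Let $n\ge2$, let $f\in\mathbb{R}[x_1,\ldots,x_n]$ be a form of degree $d>2$, let $f^*=\min\{f(\mathbf{x}):\mathbf{x}\in\mathbb{S}^{n-1}\}$, let $g(\mathbf{x})=f(\mathbf{x})\bigl(1-\tfrac{d}{d+2}\|\mathbf{x}\|^2\bigr)$, and let $V_{\rm grad}(g)=W_0\cup\tilde W_1\cup\cdots\cup\tilde W_r$ be the decomposition described in the context. Define $$\Omega:=\{\mathbf{x}\in\mathbb{S}^{n-1}: f(\mathbf{x})<0,\ \lambda_2(\nabla^2 f(\mathbf{x}))\ge-\|\nabla f(\mathbf{x})\|\}\ \cup\ \{\mathbf{x}\in\mathbb{S}^{n-1}: f(\mathbf{x})\ge0,\ \lambda_1(\nabla^2 f(\mathbf{x}))\ge\|\nabla f(\mathbf{x})\|\}.$$ (a) If there is only one index $j^*\ge1$ such that $\tilde W_{j^*}\cap\Omega\neq\emptyset$, then $f$ has no spurious local minima on $\mathbb{S}^{n-1}$. (b) If $f$ has no spurious local minima on $\mathbb{S}^{n-1}$, then all (SONC) points with value $f^*$ (i.e., all local, hence global, minimizers) belong to a unique set $\tilde W_{j^*}\cap\Omega$, and the other nonempty sets $\tilde W_j\cap\Omega$ ($j\ge1$, $j\ne j^*$) contain (SONC) points which are not local minimizers.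
   Context: $\mathbb{S}^{n-1}$ is the Euclidean unit sphere in $\mathbb{R}^n$; a form is a homogeneous polynomial; $\nabla f,\nabla^2 f$ are gradient and Hessian. For a real symmetric matrix $A$, $\lambda_1(A)\le\lambda_2(A)\le\cdots\le\lambda_n(A)$ are its eigenvalues in increasing order. Local minimizer on $\mathbb{S}^{n-1}$: a point $\mathbf{x}^*\in\mathbb{S}^{n-1}$ such that for some $\varepsilon>0$, $f(\mathbf{x}^* )\le f(\mathbf{x})$ for all $\mathbf{x}\in\mathbb{S}^{n-1}$ with $\|\mathbf{x}-\mathbf{x}^*\|<\varepsilon$; $f(\mathbf{x}^* )$ is then a local minimum. A local minimum is spurious if it is not the global minimum $f^*$ of $f$ on $\mathbb{S}^{n-1}$. A point $\mathbf{x}^*\in\mathbb{S}^{n-1}$ satisfies (FONC) if there is $\lambda^*\in\mathbb{R}$ with $\nabla f(\mathbf{x}^* )+2\lambda^*\mathbf{x}^*=0$. A (SONC) point is a point $\mathbf{x}^*\in\mathbb{S}^{n-1}$ satisfying (FONC) and, with this $\lambda^*$, $\mathbf{u}^T\nabla^2 f(\mathbf{x}^* )\mathbf{u}+2\lambda^*\ge0$ for all unit vectors $\mathbf{u}$ with $\mathbf{u}^T\mathbf{x}^*=0$. Decomposition: $V_{\rm grad}(g):=\{\mathbf{z}\in\mathbb{C}^n:\nabla g(\mathbf{z})=0\}$. It is a known fact that this variety can be written as a finite union $W_0\cup W_1\cup\cdots\cup W_s$ of subvarieties, where $W_0\cap\mathbb{R}^n=\emptyset$ ($W_0$ possibly empty),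 and $W_1,\ldots,W_s$ are irreducible with $g$ equal to a real constant on each of them. Regrouping those $W_j$, $j\ge1$, on which $g$ takes the same value gives $V_{\rm grad}(g)=W_0\cup\tilde W_1\cup\cdots\cup\tilde W_r$, where $g=g_j$ on $\tilde W_j$ for real constants $g_j$ with $g_i\ne g_j$ for $i\neq j$, $1\le i,j\le r$. *)

theory Defs
  imports
    "HOL-Analysis.Analysis"
    "HOL-Library.Poly_Mapping"
    "HOL-Computational_Algebra.Computational_Algebra"
begin

section \<open>Multivariate polynomials\<close>

text \<open>Polynomials in variables indexed by the finite type \<open>'n\<close>: finitely supported maps from
  exponent vectors to coefficients; the ring structure is that of \<^theory>\<open>HOL-Library.Poly_Mapping\<close>.\<close>

type_synonym ('n, 'a) mpoly = "('n \<Rightarrow>\<^sub>0 nat) \<Rightarrow>\<^sub>0 'a"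

definition Const :: "'a::zero \<Rightarrow> ('n, 'a) mpoly" where
  "Const c = Poly_Mapping.single 0 c"

definition Var :: "'n \<Rightarrow> ('n, 'a::zero_neq_one) mpoly" where
  "Var i = Poly_Mapping.single (Poly_Mapping.single i 1) 1"

definition mp_eval :: "('n::finite, 'a::comm_semiring_1) mpoly \<Rightarrow> 'a ^ 'n \<Rightarrow> 'a" where
  "mp_eval p x = (\<Sum>m\<in>Poly_Mapping.keys p.
      Poly_Mapping.lookup p m * (\<Prod>i\<in>UNIV. x $ i ^ Poly_Mapping.lookup m i))"

text \<open>Partial derivative with respect to the \<open>i\<close>-th variable. The exponent subtraction truncates only
  in monomials not containing that variable, and these have coefficient \<open>0\<close>.\<close>

definition mp_pderiv :: "'n \<Rightarrow> ('n, 'a::comm_semiring_1) mpoly \<Rightarrow> ('n, 'a) mpoly" where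
  "mp_pderiv i p = (\<Sum>m\<in>Poly_Mapping.keys p.
      Poly_Mapping.single (m - Poly_Mapping.single i 1)
        (of_nat (Poly_Mapping.lookup m i) * Poly_Mapping.lookup p m))"

definition grad :: "('n::finite, 'a::comm_semiring_1) mpoly \<Rightarrow> 'a ^ 'n \<Rightarrow> 'a ^ 'n" where
  "grad p x = (\<chi> i. mp_eval (mp_pderiv i p) x)"

definition hessian :: "('n::finite, 'a::comm_semiring_1) mpoly \<Rightarrow> 'a ^ 'n \<Rightarrow> 'a ^ 'n ^ 'n" where
  "hessian p x = (\<chi> i j. mp_eval (mp_pderiv i (mp_pderiv j p)) x)"

text \<open>As usual, the zero polynomial counts as a form of every degree.\<close>

definition form :: "nat \<Rightarrow> ('n::finite, 'a::zero) mpoly \<Rightarrow> bool" where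
  "form d p \<longleftrightarrow> (\<forall>m\<in>Poly_Mapping.keys p. (\<Sum>i\<in>UNIV. Poly_Mapping.lookup m i) = d)"

definition complexify :: "('n, real) mpoly \<Rightarrow> ('n, complex) mpoly" where
  "complexify p = Poly_Mapping.map complex_of_real p"

definition cvec :: "real ^ 'n \<Rightarrow> complex ^ 'n" where
  "cvec x = (\<chi> i. complex_of_real (x $ i))"

section \<open>Ordered eigenvalues\<close>

definition charpoly :: "real ^ 'n ^ 'n \<Rightarrow> real poly" where
  "charpoly A = det (mat [:0, 1:] - map_matrix (\<lambda>a. [:a:]) A)"

text \<open>The \<open>k\<close>-th smallest eigenvalue, \<open>1 \<le> k \<le> n\<close>, counted with multiplicity. It is meaningful for
  matrices with only real eigenvalues, in particular for symmetric ones.\<close>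

definition eigval :: "nat \<Rightarrow> real ^ 'n ^ 'n \<Rightarrow> real" where
  "eigval k A = sorted_list_of_multiset (proots (charpoly A)) ! (k - 1)"

section \<open>Optimization on the unit sphere\<close>

definition sphere_min :: "('n::finite, real) mpoly \<Rightarrow> real" where
  "sphere_min f = (LEAST v. v \<in> mp_eval f ` sphere 0 1)"

definition local_minimizer :: "('n::finite, real) mpoly \<Rightarrow> real ^ 'n \<Rightarrow> bool" where
  "local_minimizer f x \<longleftrightarrow> x \<in> sphere 0 1 \<and>
    (\<exists>\<epsilon>>0. \<forall>y\<in>sphere 0 1. norm (y - x) < \<epsilon> \<longrightarrow> mp_eval f x \<le> mp_eval f y)"

definition local_minimum :: "('n::finite, real) mpoly \<Rightarrow> real \<Rightarrow> bool" where
  "local_minimum f v \<longleftrightarrow> (\<exists>x. local_minimizer f x \<and> v = mp_eval f x)"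

definition spurious_local_minimum :: "('n::finite, real) mpoly \<Rightarrow> real \<Rightarrow> bool" where
  "spurious_local_minimum f v \<longleftrightarrow> local_minimum f v \<and> v \<noteq> sphere_min f"

definition SONC :: "('n::finite, real) mpoly \<Rightarrow> real ^ 'n \<Rightarrow> bool" where
  "SONC f x \<longleftrightarrow> x \<in> sphere 0 1 \<and>
    (\<exists>l. grad f x + (2 * l) *\<^sub>R x = 0 \<and>
      (\<forall>u. norm u = 1 \<and> u \<bullet> x = 0 \<longrightarrow> u \<bullet> (hessian f x *v u) + 2 * l \<ge> 0))"

section \<open>The gradient variety and its decomposition\<close>

definition variety :: "(complex ^ 'n::finite) set \<Rightarrow> bool" where
  "variety V \<longleftrightarrow> (\<exists>S. V = {z. \<forall>p\<in>S. mp_eval p z = 0})"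

definition irreducible_variety :: "(complex ^ 'n::finite) set \<Rightarrow> bool" where
  "irreducible_variety V \<longleftrightarrow> variety V \<and> V \<noteq> {} \<and>
    (\<forall>A B. variety A \<and> variety B \<and> V = A \<union> B \<longrightarrow> V = A \<or> V = B)"

definition V_grad :: "('n::finite, real) mpoly \<Rightarrow> (complex ^ 'n) set" where
  "V_grad g = {z. grad (complexify g) z = 0}"

text \<open>Here \<open>W\<^sub>0\<close> is kept separate, \<open>W 1, \<dots>, W s\<close> are the irreducible pieces, and \<open>c j\<close> is the constant
  value of \<open>g\<close> on \<open>W j\<close>.\<close>

definition grad_decomposition ::
  "('n::finite, real) mpoly \<Rightarrow> (complex ^ 'n) set \<Rightarrow> nat \<Rightarrow> (nat \<Rightarrow> (complex ^ 'n) set)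
    \<Rightarrow> (nat \<Rightarrow> real) \<Rightarrow> bool" where
  "grad_decomposition g W\<^sub>0 s W c \<longleftrightarrow>
    V_grad g = W\<^sub>0 \<union> (\<Union>j\<in>{1..s}. W j) \<and>
    variety W\<^sub>0 \<and> W\<^sub>0 \<inter> range cvec = {} \<and>
    (\<forall>j\<in>{1..s}. irreducible_variety (W j) \<and>
       (\<forall>z\<in>W j. mp_eval (complexify g) z = complex_of_real (c j)))"

text \<open>The regrouped decomposition: \<open>gval 1, \<dots>, gval r\<close> enumerates without repetition the values of \<open>g\<close>
  on the irreducible pieces, and \<open>Wt j\<close> is the union of the pieces on which \<open>g\<close> equals \<open>gval j\<close>.\<close>

definition regrouped_decomposition ::
  "('n::finite, real) mpoly \<Rightarrow> (complex ^ 'n) set \<Rightarrow> nat \<Rightarrow> (nat \<Rightarrow> (complex ^ 'n) set)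
    \<Rightarrow> (nat \<Rightarrow> real) \<Rightarrow> bool" where
  "regrouped_decomposition g W\<^sub>0 r Wt gval \<longleftrightarrow>
    (\<exists>s W c. grad_decomposition g W\<^sub>0 s W c \<and>
       inj_on gval {1..r} \<and> gval ` {1..r} = c ` {1..s} \<and>
       (\<forall>j\<in>{1..r}. Wt j = (\<Union>k\<in>{k\<in>{1..s}. c k = gval j}. W k)))"

end

theory Submission
  imports Defs
begin

text \<open>
  Write \<open>t = d * f x\<close> at a unit vector \<open>x\<close>. Euler's identity \<open>grad f x \<bullet> x = d * f x\<close> forces the
  multiplier of a first-order critical point of \<open>f\<close> on the sphere, so that such a point is one with
  \<open>grad f x = t *\<^sub>R x\<close>. The factor \<open>1 - d / (d + 2) * \<parallel>x\<parallel>\<^sup>2\<close> in \<open>g\<close> is chosen so that on the sphere \<open>grad g x\<close>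
  is \<open>2 / (d + 2)\<close> times \<open>grad f x - t *\<^sub>R x\<close> (\<open>grad_penalized_form\<close>): the real unit points of the
  gradient variety of \<open>g\<close> are exactly the critical points of \<open>f\<close> on the sphere. The set \<open>W\<^sub>0\<close> has no
  real points, so they are distributed over the sets \<open>Wt j\<close>
  (\<open>regrouped_decomposition_real_points\<close>).

  At a critical point, Euler's identity for the partial derivatives makes \<open>x\<close> an eigenvector of the
  Hessian with eigenvalue \<open>(d - 1) * t\<close>, while the second-order condition asks that the Hessian be at
  least \<open>t\<close> on the orthogonal complement of \<open>x\<close>. Also \<open>\<parallel>grad f x\<parallel> = \<bar>t\<bar>\<close>. If \<open>f x \<ge> 0\<close>, the eigenvalue
  of \<open>x\<close> is at least \<open>t = \<parallel>grad f x\<parallel>\<close>, and the condition says that the smallest eigenvalue is at least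
  \<open>t\<close>. If \<open>f x < 0\<close>, then since \<open>d > 2\<close> the eigenvalue of \<open>x\<close> lies strictly below
  \<open>t = - \<parallel>grad f x\<parallel>\<close>, and the condition says that the second smallest one is at least \<open>t\<close>. This is
  the definition of \<open>\<Omega>\<close>, so the SONC points are exactly the points of \<open>\<Omega>\<close> on some \<open>Wt j\<close>
  (\<open>critical_point_eigval_condition_iff\<close>). Translating the bounds on the \<open>k\<close>-th root of the
  characteristic polynomial into bounds on the quadratic form takes the spectral theorem
  (\<open>eigval_ge_iff_on_orthogonal_complement\<close>).

  Finally \<open>g = 2 / (d + 2) * f\<close> on the sphere, so \<open>f\<close> is constant on the unit points of each \<open>Wt j\<close> and
  takes different values on different ones. Local minimizers are SONC points
  (\<open>local_minimizer_imp_SONC\<close>) and a global minimizer exists. If only one \<open>Wt j\<close> meets \<open>\<Omega>\<close>, then all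
  SONC points, in particular all local minimizers, share the value of a global minimizer. Conversely,
  if every local minimizer is global, all of them lie on the single \<open>Wt j\<close> with the minimal value, and
  the points of \<open>\<Omega>\<close> on any other \<open>Wt j\<close> are SONC points with a larger value.
\<close>

section \<open>Evaluation of multivariate polynomials\<close>

definition monom_eval :: "('n::finite \<Rightarrow>\<^sub>0 nat) \<Rightarrow> 'a::comm_semiring_1 ^ 'n \<Rightarrow> 'a" where
  "monom_eval m x = (\<Prod>i\<in>UNIV. x $ i ^ Poly_Mapping.lookup m i)"

lemma mp_eval_eq_sum_monom_eval:
  "mp_eval p x = (\<Sum>m\<in>Poly_Mapping.keys p. Poly_Mapping.lookup p m * monom_eval m x)"
  by (simp add: mp_eval_def monom_eval_def)

lemma monom_eval_0 [simp]: "monom_eval 0 x = 1"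
  by (simp add: monom_eval_def)

lemma monom_eval_add: "monom_eval (m + k) x = monom_eval m x * monom_eval k x"
  by (simp add: monom_eval_def lookup_add power_add prod.distrib)

text \<open>Summing over a fixed superset of the support lets the terms of several polynomials be added
  monomial by monomial.\<close>

lemma mp_eval_eq_sum_superset:
  assumes "finite S" "Poly_Mapping.keys p \<subseteq> S"
  shows "mp_eval p x = (\<Sum>m\<in>S. Poly_Mapping.lookup p m * monom_eval m x)"
  unfolding mp_eval_eq_sum_monom_eval using assms
  by (intro sum.mono_neutral_left) (auto simp: in_keys_iff)

lemma mp_eval_single [simp]: "mp_eval (Poly_Mapping.single m c) x = c * monom_eval m x"
  by (subst mp_eval_eq_sum_superset[of "{m}"]) (auto split: if_splits)

lemma mp_eval_0 [simp]: "mp_eval 0 x = 0"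
  by (simp add: mp_eval_def)

lemma mp_eval_1 [simp]: "mp_eval 1 x = 1"
  by (simp flip: single_one)

lemma mp_eval_add [simp]: "mp_eval (p + q) x = mp_eval p x + mp_eval q x"
proof -
  let ?S = "Poly_Mapping.keys p \<union> Poly_Mapping.keys q"
  have "mp_eval r x = (\<Sum>m\<in>?S. Poly_Mapping.lookup r m * monom_eval m x)"
    if "r \<in> {p, q, p + q}" for r
    using that keys_add[of p q] by (intro mp_eval_eq_sum_superset) auto
  then show ?thesis
    by (simp add: lookup_add distrib_right sum.distrib)
qed

lemma mp_eval_diff [simp]:
  fixes p q :: "('n::finite, 'a::comm_ring_1) mpoly"
  shows "mp_eval (p - q) x = mp_eval p x - mp_eval q x"
  using mp_eval_add[of "p - q" q x] by simp

lemma mp_eval_sum [simp]: "mp_eval (\<Sum>a\<in>A. p a) x = (\<Sum>a\<in>A. mp_eval (p a) x)"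
  by (induction A rule: infinite_finite_induct) auto

lemma mpoly_eq_sum_single:
  "p = (\<Sum>m\<in>Poly_Mapping.keys p. Poly_Mapping.single m (Poly_Mapping.lookup p m))"
  by (rule poly_mapping_eqI)
    (auto simp: lookup_sum lookup_single when_def in_keys_iff sum.delta)

lemma mp_eval_mult [simp]: "mp_eval (p * q) x = mp_eval p x * mp_eval q x"
proof -
  have "p * q = (\<Sum>m\<in>Poly_Mapping.keys p. \<Sum>k\<in>Poly_Mapping.keys q.
      Poly_Mapping.single (m + k) (Poly_Mapping.lookup p m * Poly_Mapping.lookup q k))"
    by (subst mpoly_eq_sum_single[of p], subst mpoly_eq_sum_single[of q])
      (simp add: sum_product mult_single)
  then show ?thesis
    by (simp add: mp_eval_eq_sum_monom_eval[of p] mp_eval_eq_sum_monom_eval[of q] sum_product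
        monom_eval_add mult_ac)
qed

lemma mp_eval_power [simp]: "mp_eval (p ^ k) x = mp_eval p x ^ k"
  by (induction k) auto

lemma mp_eval_Const [simp]: "mp_eval (Const c) x = c"
  by (simp add: Const_def)

lemma mp_eval_Var [simp]: "mp_eval (Var i) x = x $ i"
proof -
  have "monom_eval (Poly_Mapping.single i 1) x = (\<Prod>j\<in>UNIV. if j = i then x $ i else 1)"
    unfolding monom_eval_def by (intro prod.cong) (auto simp: lookup_single when_def)
  then show ?thesis by (simp add: Var_def)
qed

section \<open>Derivatives and Euler identities for forms\<close>

lemma mp_eval_pderiv:
  "mp_eval (mp_pderiv i p) x = (\<Sum>m\<in>Poly_Mapping.keys p.
     of_nat (Poly_Mapping.lookup m i) * Poly_Mapping.lookup p m *
     monom_eval (m - Poly_Mapping.single i 1) x)"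
  by (simp add: mp_pderiv_def)

text \<open>When the variable \<open>i\<close> does not occur in \<open>m\<close>, both exponent subtractions truncate
  and the two sides still agree.\<close>

lemma monom_eval_diff_single:
  "monom_eval (m - Poly_Mapping.single i 1) x =
     x $ i ^ (Poly_Mapping.lookup m i - 1) * (\<Prod>j\<in>UNIV - {i}. x $ j ^ Poly_Mapping.lookup m j)"
  unfolding monom_eval_def
  by (subst prod.remove[of _ i]) (auto simp: lookup_minus lookup_single intro!: prod.cong)

text \<open>Ties the formal gradient to the analytic one. Identities such as the gradient of a product can
  then be read off from the analytic product rule and uniqueness of derivatives, without a formal
  product rule.\<close>

lemma has_derivative_mp_eval:
  fixes p :: "('n::finite, real) mpoly"
  shows "(mp_eval p has_derivative (\<lambda>h. grad p x \<bullet> h)) (at x)"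
proof -
  let ?l = "Poly_Mapping.lookup"
  have mon: "(monom_eval m has_derivative
      (\<lambda>h. \<Sum>i\<in>UNIV. real (?l m i) * monom_eval (m - Poly_Mapping.single i 1) x * h $ i)) (at x)"
    for m :: "'n \<Rightarrow>\<^sub>0 nat"
    unfolding monom_eval_def[of m, abs_def]
    by (rule has_derivative_eq_rhs, rule has_derivative_prod, rule has_derivative_power,
        rule bounded_linear_imp_has_derivative, rule bounded_linear_vec_nth)
      (simp add: fun_eq_iff monom_eval_diff_single mult_ac del: One_nat_def)
  have "((\<lambda>y. \<Sum>m\<in>Poly_Mapping.keys p. ?l p m * monom_eval m y) has_derivative
     (\<lambda>h. \<Sum>m\<in>Poly_Mapping.keys p. ?l p m *
       (\<Sum>i\<in>UNIV. real (?l m i) * monom_eval (m - Poly_Mapping.single i 1) x * h $ i))) (at x)"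
    by (intro has_derivative_sum has_derivative_mult_right mon)
  moreover have "(\<Sum>m\<in>Poly_Mapping.keys p. ?l p m *
       (\<Sum>i\<in>UNIV. real (?l m i) * monom_eval (m - Poly_Mapping.single i 1) x * h $ i))
     = grad p x \<bullet> h" for h
    by (simp add: grad_def inner_vec_def mp_eval_pderiv sum_distrib_left sum_distrib_right mult_ac)
      (subst sum.swap, simp)
  ultimately show ?thesis
    unfolding mp_eval_eq_sum_monom_eval[abs_def] by simp
qed

lemma form_mp_pderiv:
  assumes "form d p"
  shows "form (d - 1) (mp_pderiv i p)"
  unfolding form_def
proof
  fix k assume "k \<in> Poly_Mapping.keys (mp_pderiv i p)"
  then obtain m where m: "m \<in> Poly_Mapping.keys p" and k: "k = m - Poly_Mapping.single i 1"
    and i: "Poly_Mapping.lookup m i \<noteq> 0"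
    unfolding mp_pderiv_def using keys_sum by (fastforce split: if_splits)
  have "(\<Sum>j\<in>UNIV. Poly_Mapping.lookup m j) = Poly_Mapping.lookup m i + (\<Sum>j\<in>UNIV - {i}. Poly_Mapping.lookup m j)"
    by (rule sum.remove) auto
  moreover have "(\<Sum>j\<in>UNIV. Poly_Mapping.lookup k j) = (Poly_Mapping.lookup m i - 1) + (\<Sum>j\<in>UNIV - {i}. Poly_Mapping.lookup m j)"
    unfolding k by (subst sum.remove[of _ i]) (auto simp: lookup_minus lookup_single)
  moreover have "(\<Sum>j\<in>UNIV. Poly_Mapping.lookup m j) = d"
    using assms m by (auto simp: form_def)
  ultimately show "(\<Sum>j\<in>UNIV. Poly_Mapping.lookup k j) = d - 1"
    using i by simp
qed

text \<open>Euler's identity: each monomial of degree \<open>d\<close> satisfies it, since multiplying its \<open>i\<close>-th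
  derivative by the \<open>i\<close>-th variable restores the monomial with the exponent of \<open>i\<close> as a factor.\<close>

lemma euler_homogeneous:
  fixes p :: "('n::finite, 'a::comm_semiring_1) mpoly"
  assumes "form d p"
  shows "(\<Sum>i\<in>UNIV. mp_eval (mp_pderiv i p) x * x $ i) = of_nat d * mp_eval p x"
proof -
  have step: "of_nat (Poly_Mapping.lookup m i) * monom_eval (m - Poly_Mapping.single i 1) x * x $ i
      = of_nat (Poly_Mapping.lookup m i) * monom_eval m x" for m i
  proof (cases "Poly_Mapping.lookup m i")
    case (Suc k)
    then have "monom_eval m x = x $ i * monom_eval (m - Poly_Mapping.single i 1) x"
      unfolding monom_eval_diff_single unfolding monom_eval_def
      by (subst prod.remove[of _ i]) (auto simp: mult_ac)
    then show ?thesis by (simp add: mult_ac)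
  qed simp
  have "(\<Sum>i\<in>UNIV. mp_eval (mp_pderiv i p) x * x $ i) =
      (\<Sum>i\<in>UNIV. \<Sum>m\<in>Poly_Mapping.keys p. Poly_Mapping.lookup p m *
        (of_nat (Poly_Mapping.lookup m i) * monom_eval (m - Poly_Mapping.single i 1) x * x $ i))"
    by (simp add: mp_eval_pderiv sum_distrib_left mult_ac)
  also have "\<dots> = (\<Sum>m\<in>Poly_Mapping.keys p. Poly_Mapping.lookup p m * monom_eval m x *
      of_nat (\<Sum>i\<in>UNIV. Poly_Mapping.lookup m i))"
    unfolding step by (subst sum.swap) (simp add: sum_distrib_left mult_ac)
  also have "\<dots> = (\<Sum>m\<in>Poly_Mapping.keys p. of_nat d * (Poly_Mapping.lookup p m * monom_eval m x))"
    using assms by (intro sum.cong) (auto simp: form_def mult_ac simp del: of_nat_sum)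
  finally show ?thesis
    by (simp add: mp_eval_eq_sum_monom_eval sum_distrib_left)
qed

lemma mp_pderiv_eq_sum_superset:
  assumes "finite S" "Poly_Mapping.keys p \<subseteq> S"
  shows "mp_pderiv i p = (\<Sum>m\<in>S. Poly_Mapping.single (m - Poly_Mapping.single i 1)
        (of_nat (Poly_Mapping.lookup m i) * Poly_Mapping.lookup p m))"
  unfolding mp_pderiv_def using assms
  by (intro sum.mono_neutral_left) (auto simp: in_keys_iff)

lemma mp_pderiv_single: "mp_pderiv i (Poly_Mapping.single m c) =
    Poly_Mapping.single (m - Poly_Mapping.single i 1) (of_nat (Poly_Mapping.lookup m i) * c)"
  by (subst mp_pderiv_eq_sum_superset[of "{m}"]) (auto split: if_splits)

lemma mp_pderiv_add: "mp_pderiv i (p + q) = mp_pderiv i p + mp_pderiv i q"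
proof -
  let ?S = "Poly_Mapping.keys p \<union> Poly_Mapping.keys q"
  have "mp_pderiv i r = (\<Sum>m\<in>?S. Poly_Mapping.single (m - Poly_Mapping.single i 1)
        (of_nat (Poly_Mapping.lookup m i) * Poly_Mapping.lookup r m))"
    if "r \<in> {p, q, p + q}" for r
    using that keys_add[of p q] by (intro mp_pderiv_eq_sum_superset) auto
  then show ?thesis
    by (simp add: lookup_add distrib_left single_add sum.distrib)
qed

lemma mp_pderiv_sum: "mp_pderiv i (\<Sum>a\<in>A. p a) = (\<Sum>a\<in>A. mp_pderiv i (p a))"
proof (induction A rule: infinite_finite_induct)
  case empty
  then show ?case by (simp add: mp_pderiv_def)
next
  case infinite
  then show ?case by (simp add: mp_pderiv_def)
qed (simp add: mp_pderiv_add)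

text \<open>By linearity it is enough to look at a single monomial, where the two exponent decrements commute.\<close>

lemma mp_pderiv_commute: "mp_pderiv i (mp_pderiv j p) = mp_pderiv j (mp_pderiv i p)"
proof -
  have "mp_pderiv i (mp_pderiv j (Poly_Mapping.single m c)) =
        mp_pderiv j (mp_pderiv i (Poly_Mapping.single m c))" for m and c :: 'b
  proof (cases "i = j")
    case False
    have "m - Poly_Mapping.single i 1 - Poly_Mapping.single j 1 =
          m - Poly_Mapping.single j 1 - Poly_Mapping.single i 1"
      by (rule poly_mapping_eqI) (simp add: lookup_minus)
    with False show ?thesis
      by (simp add: mp_pderiv_single lookup_minus lookup_single mult_ac del: One_nat_def)
  qed simp
  then show ?thesis
    by (subst (1 2) mpoly_eq_sum_single[of p]) (simp add: mp_pderiv_sum)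
qed

lemma transpose_hessian: "transpose (hessian p x) = hessian p x"
  by (simp add: hessian_def transpose_def vec_eq_iff mp_pderiv_commute)

lemma euler_grad:
  fixes f :: "('n::finite, real) mpoly"
  assumes "form d f"
  shows "grad f x \<bullet> x = real d * mp_eval f x"
  using euler_homogeneous[OF assms, of x] by (simp add: grad_def inner_vec_def)

text \<open>Euler's identity applied to the partial derivatives, which are forms of degree \<open>d - 1\<close>. This is
  what makes a critical point on the sphere an eigenvector of the Hessian.\<close>

lemma euler_hessian:
  fixes f :: "('n::finite, real) mpoly"
  assumes "form d f"
  shows "hessian f x *v x = real (d - 1) *\<^sub>R grad f x"
  using euler_homogeneous[OF form_mp_pderiv[OF assms], of _ x]
  by (simp add: hessian_def grad_def matrix_vector_mult_def vec_eq_iff mp_pderiv_commute)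

lemma has_derivative_grad:
  fixes p :: "('n::finite, real) mpoly"
  shows "(grad p has_derivative (\<lambda>h. hessian p x *v h)) (at x)"
proof -
  have "((\<lambda>y. grad p y \<bullet> axis i 1) has_derivative (\<lambda>h. (hessian p x *v h) \<bullet> axis i 1)) (at x)" for i
  proof -
    have "grad (mp_pderiv i p) x \<bullet> h = (hessian p x *v h) \<bullet> axis i 1" for h
      by (simp add: inner_axis) (simp add: grad_def hessian_def matrix_vector_mult_def inner_vec_def
          mp_pderiv_commute)
    moreover have "grad p y \<bullet> axis i 1 = mp_eval (mp_pderiv i p) y" for y
      by (simp add: inner_axis grad_def)
    ultimately show ?thesis
      using has_derivative_mp_eval[of "mp_pderiv i p" x] by simp
  qed
  then show ?thesis
    by (subst has_derivative_componentwise_within) (auto simp: Basis_vec_def)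
qed

section \<open>Real points of complex gradient varieties\<close>

lemma keys_complexify [simp]: "Poly_Mapping.keys (complexify p) = Poly_Mapping.keys p"
  unfolding complexify_def by transfer (auto simp: when_def)

lemma lookup_complexify [simp]:
  "Poly_Mapping.lookup (complexify p) m = complex_of_real (Poly_Mapping.lookup p m)"
  unfolding complexify_def by transfer (auto simp: when_def)

lemma mp_eval_complexify:
  "mp_eval (complexify p) (cvec x) = complex_of_real (mp_eval p x)"
  by (simp add: mp_eval_def cvec_def)

lemma monom_eval_cvec: "monom_eval m (cvec x) = complex_of_real (monom_eval m x)"
  by (simp add: monom_eval_def cvec_def)

lemma grad_complexify: "grad (complexify p) (cvec x) = cvec (grad p x)"
  by (simp add: grad_def mp_eval_pderiv monom_eval_cvec vec_eq_iff del: One_nat_def)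
    (simp add: cvec_def mp_eval_pderiv)

lemma cvec_in_V_grad_iff: "cvec x \<in> V_grad p \<longleftrightarrow> grad p x = 0"
  by (simp add: V_grad_def grad_complexify) (simp add: cvec_def vec_eq_iff)

text \<open>A real critical point lies in one of the irreducible pieces because \<open>W\<^sub>0\<close> avoids the real points,
  and regrouping puts each piece into the set \<open>Wt j\<close> that carries its value.\<close>

lemma regrouped_decomposition_real_points:
  assumes "regrouped_decomposition g W\<^sub>0 r Wt gval"
  shows "grad g x = 0 \<longleftrightarrow> (\<exists>j\<in>{1..r}. cvec x \<in> Wt j)"
    and "j \<in> {1..r} \<Longrightarrow> cvec x \<in> Wt j \<Longrightarrow> mp_eval g x = gval j"
proof -
  obtain s W c where dec: "grad_decomposition g W\<^sub>0 s W c" and im: "gval ` {1..r} = c ` {1..s}"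
    and Wt: "\<forall>j\<in>{1..r}. Wt j = (\<Union>k\<in>{k\<in>{1..s}. c k = gval j}. W k)"
    using assms unfolding regrouped_decomposition_def by (elim exE conjE) (rule that)
  have V: "V_grad g = W\<^sub>0 \<union> (\<Union>j\<in>{1..s}. W j)" and W0: "cvec x \<notin> W\<^sub>0"
    and val: "\<And>j z. j \<in> {1..s} \<Longrightarrow> z \<in> W j \<Longrightarrow> mp_eval (complexify g) z = complex_of_real (c j)"
    using dec unfolding grad_decomposition_def by blast+
  have "grad g x = 0 \<longleftrightarrow> (\<exists>k\<in>{1..s}. cvec x \<in> W k)"
    using V W0 cvec_in_V_grad_iff[of x g] by blast
  also have "\<dots> \<longleftrightarrow> (\<exists>j\<in>{1..r}. cvec x \<in> Wt j)"
  proof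
    assume "\<exists>k\<in>{1..s}. cvec x \<in> W k"
    then obtain k where k: "k \<in> {1..s}" "cvec x \<in> W k" by blast
    then have "c k \<in> gval ` {1..r}" unfolding im by blast
    then obtain j where j: "j \<in> {1..r}" "c k = gval j" by blast
    then have "Wt j = (\<Union>k\<in>{k\<in>{1..s}. c k = gval j}. W k)" using Wt by blast
    with k j(2) have "cvec x \<in> Wt j" by blast
    with j(1) show "\<exists>j\<in>{1..r}. cvec x \<in> Wt j" ..
  next
    assume "\<exists>j\<in>{1..r}. cvec x \<in> Wt j"
    then show "\<exists>k\<in>{1..s}. cvec x \<in> W k" using Wt by auto
  qed
  finally show "grad g x = 0 \<longleftrightarrow> (\<exists>j\<in>{1..r}. cvec x \<in> Wt j)" .
  assume "j \<in> {1..r}" "cvec x \<in> Wt j"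
  then obtain k where "k \<in> {1..s}" "c k = gval j" "cvec x \<in> W k"
    using Wt by auto
  with val have "mp_eval (complexify g) (cvec x) = complex_of_real (gval j)" by metis
  then show "mp_eval g x = gval j" by (simp add: mp_eval_complexify)
qed

section \<open>Self-adjoint maps and ordered eigenvalues\<close>

text \<open>The maximizer \<open>v\<close> of the Rayleigh quotient on the unit sphere of \<open>S\<close> is an eigenvector. With \<open>l\<close>
  the maximum, the quadratic form \<open>q y = l * (y \<bullet> y) - y \<bullet> f y\<close> is nonnegative on \<open>S\<close> and vanishes at \<open>v\<close>,
  so its first variation \<open>l *\<^sub>R v - f v\<close> at \<open>v\<close> has to vanish.\<close>

lemma selfadjoint_unit_eigenvector:
  fixes f :: "'a::euclidean_space \<Rightarrow> 'a"
  assumes "linear f" and sym: "\<And>x y. f x \<bullet> y = x \<bullet> f y"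
    and S: "subspace S" "f ` S \<subseteq> S" "S \<noteq> {0}"
  obtains v l where "v \<in> S" "norm v = 1" "f v = l *\<^sub>R v"
proof -
  interpret f: linear f by fact
  let ?K = "S \<inter> sphere 0 1"
  obtain w where w: "w \<in> S" "w \<noteq> 0"
    using S subspace_0 by blast
  then have "w /\<^sub>R norm w \<in> ?K"
    using S(1) by (simp add: subspace_scale)
  then have "?K \<noteq> {}" by blast
  moreover have "compact ?K"
    using closed_subspace[OF S(1)] by (simp add: closed_Int_compact)
  moreover have "continuous_on ?K (\<lambda>y. y \<bullet> f y)"
    by (intro continuous_intros linear_continuous_on linear_conv_bounded_linear[THEN iffD1] \<open>linear f\<close>)
  ultimately obtain v where v: "v \<in> ?K" and max: "\<And>y. y \<in> ?K \<Longrightarrow> y \<bullet> f y \<le> v \<bullet> f v"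
    using continuous_attains_sup by metis
  have nv: "norm v = 1" and vS: "v \<in> S" using v by auto
  define l where "l = v \<bullet> f v"
  define q where "q y = l * (y \<bullet> y) - y \<bullet> f y" for y
  have q_nonneg: "q y \<ge> 0" if "y \<in> S" for y
  proof (cases "y = 0")
    case False
    then have "y /\<^sub>R norm y \<in> ?K"
      using that S(1) by (simp add: subspace_scale)
    from max[OF this] have "(y \<bullet> f y) / (norm y)\<^sup>2 \<le> l"
      by (simp add: f.scaleR l_def power2_eq_square divide_inverse mult_ac)
    then show ?thesis
      using False by (simp add: q_def divide_le_eq power2_norm_eq_inner mult_ac)
  qed (simp add: q_def f.zero)
  have qv: "q v = 0"
    using nv by (simp add: q_def l_def norm_eq_1)
  let ?w = "l *\<^sub>R v - f v"
  have wS: "?w \<in> S"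
    using vS S by (intro subspace_diff subspace_scale) auto
  have expand: "q (v + t *\<^sub>R ?w) = 2 * t * (?w \<bullet> ?w) + t\<^sup>2 * q ?w" for t
  proof -
    have "q (v + t *\<^sub>R ?w) = q v + 2 * t * (?w \<bullet> (l *\<^sub>R v - f v)) + t\<^sup>2 * q ?w"
      unfolding q_def f.add f.scaleR f.diff
      using sym[of v v] sym[of v "f v"] sym[of "f v" v] sym[of "f v" "f v"]
      by (simp add: inner_simps power2_eq_square algebra_simps inner_commute)
    then show ?thesis by (simp add: qv)
  qed
  have "?w \<bullet> ?w = 0"
  proof (rule ccontr)
    assume "?w \<bullet> ?w \<noteq> 0"
    then have pos: "?w \<bullet> ?w > 0" by simp
    \<comment> \<open>A negative step so short that the linear term of the expansion outweighs the quadratic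
      one; adding \<open>1\<close> to the denominator also covers a vanishing quadratic term.\<close>
    let ?t = "- (?w \<bullet> ?w) / (q ?w + 1)"
    have q0: "q ?w \<ge> 0" using q_nonneg wS by blast
    have tneg: "?t < 0" using pos q0 by (simp add: divide_neg_pos)
    have "?t * q ?w \<ge> - (?w \<bullet> ?w)"
      using q0 pos by (simp add: field_simps)
    then have "2 * (?w \<bullet> ?w) + ?t * q ?w > 0" using pos by linarith
    then have "?t * (2 * (?w \<bullet> ?w) + ?t * q ?w) < 0" using tneg by (rule mult_neg_pos[rotated])
    moreover have "q (v + ?t *\<^sub>R ?w) \<ge> 0"
      using vS wS S(1) by (intro q_nonneg subspace_add subspace_scale)
    moreover have "q (v + t *\<^sub>R ?w) = t * (2 * (?w \<bullet> ?w) + t * q ?w)" for t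
      unfolding expand by (simp only: power2_eq_square distrib_left mult_ac)
    ultimately show False by (metis not_le)
  qed
  then have "f v = l *\<^sub>R v" by simp
  with that nv vS show thesis by blast
qed

text \<open>The spectral theorem, by induction on the dimension: the orthogonal complement in \<open>S\<close> of one
  eigenvector is again invariant because \<open>f\<close> is self-adjoint. It is stated for invariant subspaces and
  not only for the whole space so that it can be applied to the complement of a given eigenvector,
  which is then part of the resulting eigenbasis.\<close>

lemma selfadjoint_orthonormal_eigenbasis:
  fixes f :: "'a::euclidean_space \<Rightarrow> 'a"
  assumes "linear f" and sym: "\<And>x y. f x \<bullet> y = x \<bullet> f y"
    and "subspace S" "f ` S \<subseteq> S"
  shows "\<exists>B l. B \<subseteq> S \<and> pairwise orthogonal B \<and> (\<forall>v\<in>B. norm v = 1 \<and> f v = l v *\<^sub>R v) \<and>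
    finite B \<and> card B = dim S \<and> span B = S"
  using assms(3,4)
proof (induction "dim S" arbitrary: S)
  case 0
  then have "S = {0}"
    using subspace_0 by fastforce
  then show ?case
    by (intro exI[of _ "{}"]) auto
next
  case (Suc k)
  then have "S \<noteq> {0}"
    using dim_eq_0[of S] by auto
  then obtain v c where v: "v \<in> S" "norm v = 1" "f v = c *\<^sub>R v"
    using selfadjoint_unit_eigenvector[OF assms(1,2)] Suc.prems by metis
  define T where "T = {y \<in> S. \<forall>x \<in> span {v}. orthogonal x y}"
  have T: "T = {y \<in> S. orthogonal v y}"
    unfolding T_def by (auto simp: span_singleton orthogonal_def intro: exI[of _ 1])
  have v0: "v \<noteq> 0" using v(2) by auto
  have "dim T + dim (span {v}) = dim S"
    unfolding T_def by (rule dim_subspace_orthogonal_to_vectors)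
      (use v Suc.prems in \<open>auto intro: span_minimal[THEN subsetD]\<close>)
  then have dT: "dim S = Suc (dim T)"
    using v0 by (simp add: dim_insert)
  have subT: "subspace T"
    unfolding T using Suc.prems(1) subspace_orthogonal_to_vector[of v]
    by (auto simp: subspace_def orthogonal_clauses)
  have "f ` T \<subseteq> T"
  proof (clarsimp simp: T)
    fix y assume y: "y \<in> S" "orthogonal v y"
    have "v \<bullet> f y = c * (v \<bullet> y)" using sym[of v y] v(3) by simp
    then show "f y \<in> S \<and> orthogonal v (f y)"
      using y Suc.prems(2) by (auto simp: orthogonal_def)
  qed
  with Suc.hyps(1)[of T] Suc.hyps(2) dT subT
  obtain B l where B: "B \<subseteq> T" "pairwise orthogonal B" "\<forall>v\<in>B. norm v = 1 \<and> f v = l v *\<^sub>R v"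
    "finite B" "card B = dim T" "span B = T" by auto
  have vB: "v \<notin> B"
    using B(1) v0 by (auto simp: T orthogonal_self)
  let ?B = "insert v B"
  have pw: "pairwise orthogonal ?B"
    using B(1,2) by (auto simp: pairwise_insert T orthogonal_commute)
  have card: "card ?B = dim S" using vB B dT by simp
  have "independent ?B"
    using pw v0 B(3) by (intro pairwise_orthogonal_independent) auto
  moreover have sub: "?B \<subseteq> S" using v B(1) by (auto simp: T)
  ultimately have "span ?B = S"
    using card Suc.prems(1) by (metis card_eq_dim span_subspace finite.insertI B(4) order_refl)
  moreover have "\<forall>u\<in>?B. norm u = 1 \<and> f u = (l(v := c)) u *\<^sub>R u"
    using B(3) v vB by auto
  ultimately show ?case
    using pw card sub B(4) by blast
qed

lemma map_matrix_const_poly_mult: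
  fixes X :: "'a::comm_ring_1^'k^'n" and Y :: "'a^'m^'k"
  shows "map_matrix (\<lambda>a. [:a:]) (X ** Y) = map_matrix (\<lambda>a. [:a:]) X ** map_matrix (\<lambda>a. [:a:]) Y"
  by (simp add: vec_eq_iff matrix_matrix_mult_def sum_to_poly mult_ac)

text \<open>With the eigenvectors as columns of \<open>P\<close> and the eigenvalues on the diagonal of \<open>D\<close>, the relation
  \<open>A ** P = P ** D\<close> carries over to the matrices with polynomial entries,
  \<open>(X - A) ** P = P ** (X - D)\<close>. Taking determinants and cancelling that of \<open>P\<close> leaves a product of
  linear factors.\<close>

lemma proots_charpoly_eigenbasis:
  fixes A :: "real^'n^'n"
  assumes orth: "pairwise orthogonal E" and eig: "\<And>v. v \<in> E \<Longrightarrow> norm v = 1 \<and> A *v v = l v *\<^sub>R v"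
    and card: "card E = CARD('n)"
  shows "proots (charpoly A) = image_mset l (mset_set E)"
proof -
  have "finite E" using card by (metis card.infinite zero_less_card_finite less_irrefl)
  then obtain b :: "'n \<Rightarrow> real^'n" where b: "bij_betw b UNIV E"
    using card by (metis finite_class.finite_UNIV finite_same_card_bij)
  have bE: "b i \<in> E" for i using b by (auto simp: bij_betw_def)
  have ortho: "b i \<bullet> b j = (if i = j then 1 else 0)" for i j
  proof (cases "i = j")
    case False
    then have "b i \<noteq> b j" using b by (auto simp: bij_betw_def inj_on_def)
    then show ?thesis using False orth bE by (auto simp: pairwise_def orthogonal_def)
  qed (use eig[OF bE] in \<open>simp add: norm_eq_1\<close>)
  let ?C = "map_matrix (\<lambda>a::real. [:a:])"
  define P :: "real^'n^'n" where "P = (\<chi> i j. b j $ i)"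
  define D :: "real^'n^'n" where "D = (\<chi> i j. if i = j then l (b i) else 0)"
  have PP: "transpose P ** P = mat 1"
    using ortho by (simp add: P_def transpose_def matrix_matrix_mult_def mat_def vec_eq_iff inner_vec_def)
  have AP: "A ** P = P ** D"
  proof -
    have "(A ** P) $ i $ j = (P ** D) $ i $ j" for i j
    proof -
      have "(A ** P) $ i $ j = (A *v b j) $ i"
        by (simp add: P_def matrix_matrix_mult_def matrix_vector_mult_def)
      also have "\<dots> = (P ** D) $ i $ j"
        using eig[OF bE[of j]]
        by (simp add: P_def D_def matrix_matrix_mult_def if_distrib mult.commute cong: if_cong)
      finally show ?thesis .
    qed
    then show ?thesis by (simp add: vec_eq_iff)
  qed
  let ?X = "mat [:0, 1:] :: real poly^'n^'n"
  have comm: "(?X - ?C A) ** ?C P = ?C P ** (?X - ?C D)"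
  proof -
    have "?X ** ?C P = ?C P ** ?X"
      by (simp add: vec_eq_iff matrix_matrix_mult_def mat_def if_distrib if_distribR mult.commute cong: if_cong)
    moreover have "?C A ** ?C P = ?C P ** ?C D"
      by (metis AP map_matrix_const_poly_mult)
    moreover have "(Y - Z) ** W = Y ** W - Z ** W" "W ** (Y - Z) = W ** Y - W ** Z"
      for Y Z W :: "real poly^'n^'n"
      by (simp_all add: vec_eq_iff matrix_matrix_mult_def left_diff_distrib right_diff_distrib
          sum_subtractf)
    ultimately show ?thesis by simp
  qed
  have "det (?C P) \<noteq> 0"
  proof
    assume "det (?C P) = 0"
    then have "det (?C (transpose P ** P)) = 0"
      by (simp add: map_matrix_const_poly_mult det_mul)
    moreover have "?C (mat 1) = mat 1"
      by (simp add: vec_eq_iff mat_def)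
    ultimately show False
      by (metis PP det_I zero_neq_one)
  qed
  moreover have "charpoly A * det (?C P) = det (?C P) * det (?X - ?C D)"
    using comm unfolding charpoly_def by (metis det_mul)
  ultimately have "charpoly A = det (?X - ?C D)"
    by (simp add: mult.commute)
  also have "\<dots> = (\<Prod>i\<in>UNIV. (?X - ?C D) $ i $ i)"
    by (rule det_diagonal) (simp add: mat_def D_def)
  also have "\<dots> = (\<Prod>i\<in>UNIV. [:- l (b i), 1:])"
    by (simp add: mat_def D_def)
  also have "\<dots> = (\<Prod>v\<in>E. [:- l v, 1:])"
    using b by (rule prod.reindex_bij_betw)
  finally have "proots (charpoly A) = (\<Sum>v\<in>E. {#l v#})"
    by (simp add: proots_prod)
  also have "\<dots> = image_mset l (mset_set E)"
    using \<open>finite E\<close> by (induction E) auto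
  finally show ?thesis .
qed

text \<open>Turns the position in a sorted list into a count, which is additive and does not
  depend on how the elements are ordered.\<close>

lemma sorted_list_of_multiset_nth_ge_iff:
  assumes "k < size M"
  shows "t \<le> sorted_list_of_multiset M ! k \<longleftrightarrow> size {#y \<in># M. y < t#} \<le> k"
proof -
  define xs where "xs = sorted_list_of_multiset M"
  have M: "M = mset xs" and s: "sorted xs" by (simp_all add: xs_def)
  have k: "k < length xs" using assms by (simp add: M)
  have sz: "size {#y \<in># M. y < t#} = card {i. i < length xs \<and> xs ! i < t}"
    by (simp add: M length_filter_conv_card flip: mset_filter)
  have "size {#y \<in># M. y < t#} \<le> k" if "t \<le> xs ! k"
  proof -
    have "{i. i < length xs \<and> xs ! i < t} \<subseteq> {..<k}"
    proof safe
      fix i assume i: "i < length xs" "xs ! i < t"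
      show "i < k"
      proof (rule ccontr)
        assume "\<not> i < k"
        then have "xs ! k \<le> xs ! i" using s i by (simp add: sorted_nth_mono)
        with that i show False by simp
      qed
    qed
    from card_mono[OF _ this] show ?thesis by (simp add: sz)
  qed
  moreover have "size {#y \<in># M. y < t#} > k" if "xs ! k < t"
  proof -
    have "{..k} \<subseteq> {i. i < length xs \<and> xs ! i < t}"
    proof safe
      fix i assume "i \<le> k"
      then have "xs ! i \<le> xs ! k" using s k by (simp add: sorted_nth_mono)
      with that show "xs ! i < t" by simp
    qed (use k in auto)
    from card_mono[OF _ this] show ?thesis by (simp add: sz)
  qed
  ultimately show ?thesis
    unfolding xs_def by (meson not_le)
qed

text \<open>An eigenvalue bound equivalent to a bound on the quadratic form on the complement of a known
  eigenvector \<open>x\<close>. Complete \<open>x\<close> to an orthonormal eigenbasis: the form is at least \<open>t\<close> on the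
  complement iff no other basis vector has an eigenvalue below \<open>t\<close>. The index \<open>k\<close> accounts for whether
  the eigenvalue \<open>\<mu>\<close> of \<open>x\<close> itself lies below \<open>t\<close>.\<close>

lemma eigval_ge_iff_on_orthogonal_complement:
  fixes A :: "real^'n^'n"
  assumes sym: "transpose A = A" and x: "norm x = 1" "A *v x = \<mu> *\<^sub>R x"
    and k: "k = (if \<mu> < t then 2 else 1)" "k \<le> CARD('n)"
  shows "t \<le> eigval k A \<longleftrightarrow> (\<forall>u. norm u = 1 \<and> u \<bullet> x = 0 \<longrightarrow> t \<le> u \<bullet> (A *v u))"
proof -
  have adj: "(A *v u) \<bullet> w = u \<bullet> (A *v w)" for u w
    by (metis dot_lmul_matrix sym transpose_matrix_vector)
  define S where "S = {u. orthogonal x u}"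
  have S: "subspace S" unfolding S_def by (rule subspace_orthogonal_to_vector)
  have inv: "(*v) A ` S \<subseteq> S"
  proof -
    have "x \<bullet> (A *v u) = \<mu> * (x \<bullet> u)" for u
      using adj[of x u] x(2) by simp
    then show ?thesis by (auto simp: S_def orthogonal_def)
  qed
  have "dim S = CARD('n) - 1"
    using dim_hyperplane[of x] x(1) unfolding S_def orthogonal_def by fastforce
  with selfadjoint_orthonormal_eigenbasis[OF matrix_vector_mul_linear adj S inv]
  obtain B l where B: "B \<subseteq> S" "pairwise orthogonal B" "\<And>v. v \<in> B \<Longrightarrow> norm v = 1 \<and> A *v v = l v *\<^sub>R v"
    and fin: "finite B" and card: "card B = CARD('n) - 1" and span: "span B = S" by auto
  have xB: "x \<notin> B" using B(1) x(1) by (auto simp: S_def orthogonal_self)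
  have E: "pairwise orthogonal (insert x B)"
    using B(1,2) by (auto simp: pairwise_insert S_def orthogonal_commute)
  have cardE: "card (insert x B) = CARD('n)"
    using xB fin card by simp
  have "proots (charpoly A) = image_mset (l(x := \<mu>)) (mset_set (insert x B))"
    by (rule proots_charpoly_eigenbasis[OF E _ cardE]) (use B(3) x xB in auto)
  also have "\<dots> = add_mset \<mu> (image_mset l (mset_set B))"
    using fin xB by (auto intro!: image_mset_cong)
  finally have roots: "proots (charpoly A) = add_mset \<mu> (image_mset l (mset_set B))" .
  have "t \<le> eigval k A \<longleftrightarrow> size {#y \<in># proots (charpoly A). y < t#} \<le> k - 1"
    unfolding eigval_def
    by (rule sorted_list_of_multiset_nth_ge_iff) (use k card roots in \<open>auto split: if_splits\<close>)
  \<comment> \<open>The root \<open>\<mu>\<close> takes up the one allowed element below \<open>t\<close> exactly when \<open>k = 2\<close>.\<close>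
  also have "\<dots> \<longleftrightarrow> size {#y \<in># image_mset l (mset_set B). y < t#} = 0"
    using k(1) by (simp add: roots)
  also have "\<dots> \<longleftrightarrow> (\<forall>v\<in>B. t \<le> l v)"
    using fin by (auto simp: not_less)
  also have "\<dots> \<longleftrightarrow> (\<forall>u. norm u = 1 \<and> u \<bullet> x = 0 \<longrightarrow> t \<le> u \<bullet> (A *v u))"
  proof safe
    fix v assume *: "\<forall>u. norm u = 1 \<and> u \<bullet> x = 0 \<longrightarrow> t \<le> u \<bullet> (A *v u)" and v: "v \<in> B"
    have "v \<bullet> x = 0" using v B(1) by (auto simp: S_def orthogonal_def inner_commute)
    with * B(3)[OF v] have "t \<le> v \<bullet> (l v *\<^sub>R v)" by metis
    then show "t \<le> l v" using B(3)[OF v] by (simp add: norm_eq_1)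
  next
    fix u assume *: "\<forall>v\<in>B. t \<le> l v" and u: "norm u = 1" "u \<bullet> x = 0"
    have "u \<in> span B" using u by (simp add: span S_def orthogonal_def inner_commute)
    then have exp: "(\<Sum>v\<in>B. (u \<bullet> v) *\<^sub>R v) = u"
      using B fin by (intro orthonormal_basis_expand) auto
    have "t = t * (u \<bullet> u)" using u by (simp add: norm_eq_1)
    also have "u \<bullet> u = (\<Sum>v\<in>B. (u \<bullet> v)\<^sup>2)"
      by (subst (2) exp[symmetric]) (simp add: inner_sum_right power2_eq_square)
    also have "t * \<dots> \<le> (\<Sum>v\<in>B. l v * (u \<bullet> v)\<^sup>2)"
      using * by (auto simp: sum_distrib_left intro!: sum_mono mult_right_mono)
    also have "\<dots> = (\<Sum>v\<in>B. (u \<bullet> v) * (u \<bullet> (A *v v)))"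
      using B(3) by (intro sum.cong) (auto simp: power2_eq_square)
    also have "\<dots> = u \<bullet> (A *v (\<Sum>v\<in>B. (u \<bullet> v) *\<^sub>R v))"
      by (simp add: linear_sum[OF matrix_vector_mul_linear] matrix_vector_mult_scaleR inner_sum_right)
    finally show "t \<le> u \<bullet> (A *v u)" by (simp add: exp)
  qed
  finally show ?thesis .
qed

section \<open>Optimality conditions on the sphere\<close>

text \<open>If the second derivative were negative at \<open>a\<close>, the first one would be negative just to the right
  of \<open>a\<close>, and the mean value theorem would give smaller values there.\<close>

lemma second_order_necessary_condition_real:
  fixes \<phi> \<phi>' :: "real \<Rightarrow> real"
  assumes der: "\<And>t. (\<phi> has_real_derivative \<phi>' t) (at t)"
    and der2: "(\<phi>' has_real_derivative D) (at a)"
    and min: "\<epsilon> > 0" "\<And>t. \<bar>t - a\<bar> < \<epsilon> \<Longrightarrow> \<phi> a \<le> \<phi> t"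
  shows "\<phi>' a = 0" and "D \<ge> 0"
proof -
  show zero: "\<phi>' a = 0"
    using DERIV_local_min[OF der min(1)] min(2) by (simp add: abs_minus_commute)
  show "D \<ge> 0"
  proof (rule ccontr)
    assume "\<not> D \<ge> 0"
    then obtain \<delta> where \<delta>: "\<delta> > 0" "\<And>h. 0 < h \<Longrightarrow> h < \<delta> \<Longrightarrow> \<phi>' (a + h) < 0"
      using DERIV_neg_dec_right[OF der2] zero by auto
    define h where "h = min \<delta> \<epsilon> / 2"
    have h: "0 < h" "h < \<delta>" "h < \<epsilon>"
      using \<delta>(1) min(1) by (auto simp: h_def)
    obtain z where z: "a < z" "z < a + h" "\<phi> (a + h) - \<phi> a = (a + h - a) * \<phi>' z"
      using MVT2[of a "a + h" \<phi> \<phi>'] der h(1) by auto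
    have "\<phi>' z < 0"
      using \<delta>(2)[of "z - a"] z h by simp
    then have "\<phi> (a + h) < \<phi> a"
      using z(3) h(1) using mult_pos_neg[of h "\<phi>' z"] by simp
    moreover have "\<phi> a \<le> \<phi> (a + h)"
      using min(2)[of "a + h"] h by simp
    ultimately show False by simp
  qed
qed

text \<open>Restrict \<open>f\<close> to the great circle through \<open>x\<close> in direction \<open>u\<close>, where \<open>x\<close> becomes a local minimum of
  a function on the real line. Since the circle has acceleration \<open>- x\<close> at \<open>x\<close>, the second derivative
  there is \<open>u \<bullet> (hessian f x *v u) - grad f x \<bullet> x\<close>.\<close>

lemma local_minimizer_second_order:
  fixes f :: "('n::finite, real) mpoly"
  assumes min: "local_minimizer f x" and u: "norm u = 1" "u \<bullet> x = 0"
  shows "grad f x \<bullet> u = 0" and "u \<bullet> (hessian f x *v u) \<ge> grad f x \<bullet> x"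
proof -
  obtain \<epsilon> where x: "norm x = 1" and \<epsilon>: "\<epsilon> > 0"
    and le: "\<And>y. y \<in> sphere 0 1 \<Longrightarrow> norm (y - x) < \<epsilon> \<Longrightarrow> mp_eval f x \<le> mp_eval f y"
    using min by (auto simp: local_minimizer_def)
  define c where "c t = cos t *\<^sub>R x + sin t *\<^sub>R u" for t
  define c' where "c' t = - sin t *\<^sub>R x + cos t *\<^sub>R u" for t
  have c: "(c has_vector_derivative c' t) (at t)" for t
    unfolding c_def[abs_def] c'_def by (auto intro!: derivative_eq_intros)
  have c': "(c' has_vector_derivative - c t) (at t)" for t
    unfolding c_def c'_def[abs_def] by (auto intro!: derivative_eq_intros)
  have c0: "c 0 = x" "c' 0 = u" by (simp_all add: c_def c'_def)
  have "c t \<bullet> c t = (cos t)\<^sup>2 + (sin t)\<^sup>2" for t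
  proof -
    have "x \<bullet> x = 1" "u \<bullet> u = 1" "x \<bullet> u = 0"
      using x u by (simp_all add: norm_eq_1 inner_commute)
    then show ?thesis
      by (simp add: c_def inner_add_left inner_add_right u(2) power2_eq_square)
  qed
  then have "norm (c t) = 1" for t by (simp add: norm_eq_1)
  then have sph: "c t \<in> sphere 0 1" for t by simp
  define \<phi>' where "\<phi>' t = grad f (c t) \<bullet> c' t" for t
  have d1: "((\<lambda>t. mp_eval f (c t)) has_real_derivative \<phi>' t) (at t)" for t
    unfolding has_field_derivative_def
    by (rule has_derivative_eq_rhs,
        rule has_derivative_compose[OF c[of t, unfolded has_vector_derivative_def] has_derivative_mp_eval[of f]])
      (simp add: fun_eq_iff \<phi>'_def)
  have "((\<lambda>t. grad f (c t)) has_derivative (\<lambda>s. s *\<^sub>R (hessian f (c 0) *v c' 0))) (at 0)"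
    using has_derivative_compose[OF c[of 0, unfolded has_vector_derivative_def] has_derivative_grad[of f]]
    by (simp add: matrix_vector_mult_scaleR)
  from has_derivative_inner[OF this c'[of 0, unfolded has_vector_derivative_def]]
  have d2: "(\<phi>' has_real_derivative (u \<bullet> (hessian f x *v u) - grad f x \<bullet> x)) (at 0)"
    unfolding \<phi>'_def[abs_def] has_field_derivative_def c0
    by (rule has_derivative_eq_rhs) (simp add: fun_eq_iff algebra_simps inner_commute)
  have "isCont c 0"
    using c by (rule has_vector_derivative_continuous)
  then obtain \<delta> where \<delta>: "\<delta> > 0" "\<And>t. \<bar>t - 0\<bar> < \<delta> \<Longrightarrow> norm (c t - c 0) < \<epsilon>"
    using \<epsilon> unfolding continuous_at_eps_delta by (auto simp: dist_norm)
  then have min0: "mp_eval f (c 0) \<le> mp_eval f (c t)" if "\<bar>t - 0\<bar> < \<delta>" for t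
    using le[OF sph] that c0 by simp
  from second_order_necessary_condition_real[OF d1 d2 \<delta>(1) min0]
  show "grad f x \<bullet> u = 0" "u \<bullet> (hessian f x *v u) \<ge> grad f x \<bullet> x"
    by (simp_all add: \<phi>'_def c0)
qed

text \<open>By Euler's identity the only possible multiplier is \<open>l = - (d * f x) / 2\<close>.\<close>

lemma SONC_form_iff:
  fixes f :: "('n::finite, real) mpoly"
  assumes "form d f" and x: "norm x = 1"
  shows "SONC f x \<longleftrightarrow> grad f x = (real d * mp_eval f x) *\<^sub>R x \<and>
    (\<forall>u. norm u = 1 \<and> u \<bullet> x = 0 \<longrightarrow> real d * mp_eval f x \<le> u \<bullet> (hessian f x *v u))"
proof -
  have mult: "2 * l = - (real d * mp_eval f x)" if "grad f x + (2 * l) *\<^sub>R x = 0" for l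
  proof -
    have "(grad f x + (2 * l) *\<^sub>R x) \<bullet> x = 0" by (simp add: that)
    then show ?thesis
      using x euler_grad[OF assms(1), of x] by (simp add: inner_add_left norm_eq_1)
  qed
  show ?thesis
  proof
    assume "SONC f x"
    then obtain l where l: "grad f x + (2 * l) *\<^sub>R x = 0"
      and nn: "\<And>u. norm u = 1 \<and> u \<bullet> x = 0 \<Longrightarrow> u \<bullet> (hessian f x *v u) + 2 * l \<ge> 0"
      by (auto simp: SONC_def)
    then show "grad f x = (real d * mp_eval f x) *\<^sub>R x \<and>
      (\<forall>u. norm u = 1 \<and> u \<bullet> x = 0 \<longrightarrow> real d * mp_eval f x \<le> u \<bullet> (hessian f x *v u))"
      unfolding mult[OF l] by force
  next
    assume "grad f x = (real d * mp_eval f x) *\<^sub>R x \<and>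
      (\<forall>u. norm u = 1 \<and> u \<bullet> x = 0 \<longrightarrow> real d * mp_eval f x \<le> u \<bullet> (hessian f x *v u))"
    then show "SONC f x"
      unfolding SONC_def using x
      by (intro conjI exI[of _ "- (real d * mp_eval f x) / 2"]) auto
  qed
qed

text \<open>By the first-order condition along great circles, the gradient has no component orthogonal to \<open>x\<close>.\<close>

lemma local_minimizer_imp_SONC:
  fixes f :: "('n::finite, real) mpoly"
  assumes "form d f" and min: "local_minimizer f x"
  shows "SONC f x"
proof -
  have x: "norm x = 1" using min by (simp add: local_minimizer_def)
  let ?w = "grad f x - (grad f x \<bullet> x) *\<^sub>R x"
  have wx: "?w \<bullet> x = 0" using x by (simp add: inner_diff_left norm_eq_1)
  have "?w = 0"
  proof (rule ccontr)
    assume w: "?w \<noteq> 0"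
    have "grad f x \<bullet> (?w /\<^sub>R norm ?w) = 0"
      by (rule local_minimizer_second_order(1)[OF min]) (use w wx in auto)
    then have "grad f x \<bullet> ?w = 0" using w by simp
    then have "?w \<bullet> ?w = 0" using wx by (simp add: inner_diff_left inner_commute)
    then show False using w by simp
  qed
  then show ?thesis
    using local_minimizer_second_order(2)[OF min]
    unfolding SONC_form_iff[OF assms(1) x] euler_grad[OF assms(1)] by auto
qed

text \<open>With \<open>t = d * f x\<close>, the Hessian has the eigenvector \<open>x\<close> with eigenvalue \<open>(d - 1) * t\<close>, and because
  of \<open>d > 2\<close> this lies below \<open>t\<close> exactly when \<open>f x < 0\<close>. So \<open>x\<close> uses up the smallest eigenvalue in that
  case, and only in that case does the bound concern the second one.\<close>

lemma critical_point_eigval_condition_iff: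
  fixes f :: "('n::finite, real) mpoly"
  assumes n: "CARD('n) \<ge> 2" and d: "d > 2" and f: "form d f"
    and x: "norm x = 1" and crit: "grad f x = (real d * mp_eval f x) *\<^sub>R x"
  shows "(mp_eval f x < 0 \<and> eigval 2 (hessian f x) \<ge> - norm (grad f x)) \<or>
      (mp_eval f x \<ge> 0 \<and> eigval 1 (hessian f x) \<ge> norm (grad f x)) \<longleftrightarrow>
    (\<forall>u. norm u = 1 \<and> u \<bullet> x = 0 \<longrightarrow> real d * mp_eval f x \<le> u \<bullet> (hessian f x *v u))"
proof -
  let ?t = "real d * mp_eval f x" and ?\<mu> = "real (d - 1) * (real d * mp_eval f x)"
  have H: "hessian f x *v x = ?\<mu> *\<^sub>R x"
    by (simp add: euler_hessian[OF f] crit)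
  have \<mu>: "?\<mu> < ?t \<longleftrightarrow> mp_eval f x < 0"
  proof -
    have "?\<mu> - ?t = real d * real (d - 2) * mp_eval f x"
      using d by (simp add: of_nat_diff algebra_simps)
    moreover have "real d * real (d - 2) > 0" using d by simp
    ultimately show ?thesis
      by (metis diff_less_0_iff_less mult_less_0_iff not_less_iff_gr_or_eq)
  qed
  have norm: "norm (grad f x) = real d * \<bar>mp_eval f x\<bar>"
    by (simp add: crit x abs_mult)
  show ?thesis
  proof (cases "mp_eval f x < 0")
    case True
    then show ?thesis
      using eigval_ge_iff_on_orthogonal_complement[OF transpose_hessian x H, of 2 ?t] n \<mu> norm by simp
  next
    case False
    then show ?thesis
      using eigval_ge_iff_on_orthogonal_complement[OF transpose_hessian x H, of 1 ?t] n \<mu> norm by simp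
  qed
qed

lemma sphere_min_attained:
  fixes f :: "('n::finite, real) mpoly"
  obtains x where "x \<in> sphere 0 1" "mp_eval f x = sphere_min f"
    "\<And>y. y \<in> sphere 0 1 \<Longrightarrow> sphere_min f \<le> mp_eval f y"
proof -
  have "continuous_on (sphere 0 1) (mp_eval f)"
    using has_derivative_mp_eval by (blast intro: continuous_at_imp_continuous_on has_derivative_continuous)
  moreover have "axis undefined 1 \<in> (sphere 0 1 :: (real^'n) set)" by simp
  ultimately obtain x where x: "x \<in> sphere 0 1" "\<And>y. y \<in> sphere 0 1 \<Longrightarrow> mp_eval f x \<le> mp_eval f y"
    using continuous_attains_inf[OF compact_sphere, of 0 1 "mp_eval f"] by auto
  then have "sphere_min f = mp_eval f x"
    unfolding sphere_min_def by (intro Least_equality) auto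
  with x that show thesis by metis
qed

section \<open>The penalized form and its critical points\<close>

lemma mp_eval_penalized_form:
  fixes f :: "('n::finite, real) mpoly"
  shows "mp_eval (f * (1 - Const c * (\<Sum>i\<in>UNIV. Var i ^ 2))) x = mp_eval f x * (1 - c * (x \<bullet> x))"
  by (simp add: inner_vec_def power2_eq_square)

text \<open>For \<open>c = d / (d + 2)\<close> and \<open>\<parallel>x\<parallel> = 1\<close> the two coefficients \<open>1 - c\<close> and \<open>2 * c\<close> have the ratio \<open>1 : d\<close>, which
  matches the critical point equation \<open>grad f x = (d * f x) *\<^sub>R x\<close>.\<close>

lemma grad_penalized_form:
  fixes f :: "('n::finite, real) mpoly"
  shows "grad (f * (1 - Const c * (\<Sum>i\<in>UNIV. Var i ^ 2))) x =
    (1 - c * (x \<bullet> x)) *\<^sub>R grad f x - (2 * c * mp_eval f x) *\<^sub>R x" (is "grad ?g x = ?v")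
proof -
  have eq: "mp_eval ?g = (\<lambda>y. mp_eval f y * (1 - c * (y \<bullet> y)))"
    by (rule ext) (rule mp_eval_penalized_form)
  have "(mp_eval ?g has_derivative (\<lambda>h. ?v \<bullet> h)) (at x)"
    unfolding eq
    by (auto intro!: derivative_eq_intros has_derivative_mp_eval
        simp: fun_eq_iff inner_simps algebra_simps inner_commute)
  then have "(\<lambda>h. grad ?g x \<bullet> h) = (\<lambda>h. ?v \<bullet> h)"
    using has_derivative_mp_eval by (rule has_derivative_unique[rotated])
  then show ?thesis by (metis vector_eq_rdot)
qed

theorem theorem3p3:
  fixes f g :: "('n::finite, real) mpoly" and d r :: nat
    and W\<^sub>0 :: "(complex ^ 'n) set" and Wt :: "nat \<Rightarrow> (complex ^ 'n) set"
    and gval :: "nat \<Rightarrow> real" and \<Omega> :: "(real ^ 'n) set"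
  assumes "CARD('n) \<ge> 2" and "d > 2" and "form d f"
    and g: "g = f * (1 - Const (real d / (real d + 2)) * (\<Sum>i\<in>UNIV. Var i ^ 2))"
    and decomp: "regrouped_decomposition g W\<^sub>0 r Wt gval"
    and \<Omega>: "\<Omega> =
      {x \<in> sphere 0 1. mp_eval f x < 0 \<and> eigval 2 (hessian f x) \<ge> - norm (grad f x)} \<union>
      {x \<in> sphere 0 1. mp_eval f x \<ge> 0 \<and> eigval 1 (hessian f x) \<ge> norm (grad f x)}"
  shows "((\<exists>!j. j \<in> {1..r} \<and> Wt j \<inter> cvec ` \<Omega> \<noteq> {}) \<longrightarrow>
            (\<nexists>v. spurious_local_minimum f v)) \<and>
         ((\<nexists>v. spurious_local_minimum f v) \<longrightarrow>
            {x. SONC f x \<and> mp_eval f x = sphere_min f} = {x. local_minimizer f x} \<and>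
            {x. local_minimizer f x} = {x \<in> sphere 0 1. mp_eval f x = sphere_min f} \<and>
            (\<exists>!j. j \<in> {1..r} \<and>
               cvec ` {x. SONC f x \<and> mp_eval f x = sphere_min f} \<subseteq> Wt j \<inter> cvec ` \<Omega>) \<and>
            (\<forall>j\<^sub>0\<in>{1..r}.
               cvec ` {x. SONC f x \<and> mp_eval f x = sphere_min f} \<subseteq> Wt j\<^sub>0 \<inter> cvec ` \<Omega> \<longrightarrow>
               (\<forall>j\<in>{1..r}. j \<noteq> j\<^sub>0 \<and> Wt j \<inter> cvec ` \<Omega> \<noteq> {} \<longrightarrow>
                  Wt j \<inter> cvec ` \<Omega> \<subseteq> cvec ` {x. SONC f x \<and> \<not> local_minimizer f x})))"
proof -
  let ?c = "real d / (real d + 2)"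
  have c: "1 - ?c = 2 / (real d + 2)" by (simp add: field_simps)
  have crit: "grad g x = 0 \<longleftrightarrow> grad f x = (real d * mp_eval f x) *\<^sub>R x" if "norm x = 1" for x
  proof -
    have "grad g x = (1 - ?c) *\<^sub>R grad f x - (2 * ?c * mp_eval f x) *\<^sub>R x"
      using that by (simp add: g grad_penalized_form norm_eq_1)
    also have "\<dots> = (2 / (real d + 2)) *\<^sub>R (grad f x - (real d * mp_eval f x) *\<^sub>R x)"
      unfolding c by (simp add: scaleR_diff_right)
    finally show ?thesis by simp
  qed
  have g_sphere: "mp_eval g x = 2 / (real d + 2) * mp_eval f x" if "norm x = 1" for x
    using that by (simp add: g mp_eval_penalized_form norm_eq_1 c del: mp_eval_mult)
  have \<Omega>_iff: "x \<in> \<Omega> \<longleftrightarrow> norm x = 1 \<and>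
      ((mp_eval f x < 0 \<and> eigval 2 (hessian f x) \<ge> - norm (grad f x)) \<or>
       (mp_eval f x \<ge> 0 \<and> eigval 1 (hessian f x) \<ge> norm (grad f x)))" for x
    by (auto simp: \<Omega>)
  have SONC_norm: "norm x = 1" if "SONC f x" for x
    using that by (simp add: SONC_def)
  have SONC_iff: "SONC f x \<longleftrightarrow> x \<in> \<Omega> \<and> (\<exists>j\<in>{1..r}. cvec x \<in> Wt j)" for x
  proof (cases "norm x = 1")
    case True
    show ?thesis
      unfolding SONC_form_iff[OF \<open>form d f\<close> True] \<Omega>_iff
        regrouped_decomposition_real_points(1)[OF decomp, symmetric] crit[OF True]
      using critical_point_eigval_condition_iff[OF assms(1-3) True] True by blast
  next
    case False
    then show ?thesis using SONC_norm \<Omega>_iff by blast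
  qed
  \<comment> \<open>As \<open>gval\<close> is injective, the value of \<open>f\<close> at a unit vector determines the only \<open>Wt j\<close>
    that can contain it.\<close>
  have value_eq: "mp_eval f x = (real d + 2) / 2 * gval j"
    if "j \<in> {1..r}" "cvec x \<in> Wt j" "norm x = 1" for x j
    using regrouped_decomposition_real_points(2)[OF decomp that(1,2)] g_sphere[OF that(3)]
    by (simp add: field_simps add_nonneg_eq_0_iff)
  have inj: "inj_on gval {1..r}"
    using decomp by (auto simp: regrouped_decomposition_def)
  obtain x0 where x0: "x0 \<in> sphere 0 1" "mp_eval f x0 = sphere_min f"
    and min: "\<And>y. y \<in> sphere 0 1 \<Longrightarrow> sphere_min f \<le> mp_eval f y"
    using sphere_min_attained by blast
  have global_local: "local_minimizer f x" if "x \<in> sphere 0 1" "mp_eval f x = sphere_min f" for x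
    unfolding local_minimizer_def using that min by (auto intro!: exI[of _ 1])
  have local_SONC: "SONC f x" if "local_minimizer f x" for x
    using local_minimizer_imp_SONC[OF \<open>form d f\<close> that] .
  have SONC_x0: "SONC f x0"
    using x0 global_local local_SONC by blast
  then obtain j0 where j0: "j0 \<in> {1..r}" "cvec x0 \<in> Wt j0" and "x0 \<in> \<Omega>"
    using SONC_iff by blast
  show ?thesis
  proof (intro conjI impI)
    assume unique: "\<exists>!j. j \<in> {1..r} \<and> Wt j \<inter> cvec ` \<Omega> \<noteq> {}"
    have "mp_eval f x = sphere_min f" if x: "local_minimizer f x" for x
    proof -
      have S: "SONC f x" by (rule local_SONC[OF x])
      then obtain j where j: "j \<in> {1..r}" "cvec x \<in> Wt j" and "x \<in> \<Omega>"
        using SONC_iff by blast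
      then have "j = j0" using unique j0 \<open>x0 \<in> \<Omega>\<close> by blast
      then show ?thesis
        using value_eq[OF j SONC_norm[OF S]] value_eq[OF j0 SONC_norm[OF SONC_x0]] x0 by simp
    qed
    then show "\<nexists>v. spurious_local_minimum f v"
      by (auto simp: spurious_local_minimum_def local_minimum_def)
  next
    assume "\<nexists>v. spurious_local_minimum f v"
    then have nospur: "mp_eval f x = sphere_min f" if "local_minimizer f x" for x
      using that by (auto simp: spurious_local_minimum_def local_minimum_def)
    let ?M = "{x. SONC f x \<and> mp_eval f x = sphere_min f}"
    show "?M = {x. local_minimizer f x}"
      using nospur local_SONC global_local by (auto simp: SONC_def)
    show "{x. local_minimizer f x} = {x \<in> sphere 0 1. mp_eval f x = sphere_min f}"
      using nospur global_local by (auto simp: local_minimizer_def)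
    have same: "j = j'" if "j \<in> {1..r}" "cvec x \<in> Wt j" "norm x = 1" "j' \<in> {1..r}"
      "cvec y \<in> Wt j'" "norm y = 1" "mp_eval f x = mp_eval f y" for j j' x y
    proof -
      have "gval j = gval j'"
        using value_eq[OF that(1-3)] value_eq[OF that(4-6)] that(7) by simp
      then show ?thesis using inj that(1,4) by (auto dest: inj_onD)
    qed
    have M_Wt: "cvec ` ?M \<subseteq> Wt j0 \<inter> cvec ` \<Omega>"
    proof clarify
      fix x assume x: "SONC f x" "mp_eval f x = sphere_min f"
      then obtain j where j: "j \<in> {1..r}" "cvec x \<in> Wt j" and "x \<in> \<Omega>"
        using SONC_iff by blast
      moreover have "j = j0"
        using same[OF j SONC_norm[OF x(1)] j0 SONC_norm[OF SONC_x0]] x x0 by simp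
      ultimately show "cvec x \<in> Wt j0 \<inter> cvec ` \<Omega>" by blast
    qed
    have M_unique: "j = j0" if j: "j \<in> {1..r}" "cvec ` ?M \<subseteq> Wt j \<inter> cvec ` \<Omega>" for j
    proof -
      have "cvec x0 \<in> Wt j" using j(2) SONC_x0 x0(2) by blast
      then show ?thesis using same[OF j(1) _ _ j0] SONC_norm[OF SONC_x0] by blast
    qed
    show "\<exists>!j. j \<in> {1..r} \<and> cvec ` ?M \<subseteq> Wt j \<inter> cvec ` \<Omega>"
    proof (rule ex1I)
      show "j0 \<in> {1..r} \<and> cvec ` ?M \<subseteq> Wt j0 \<inter> cvec ` \<Omega>"
        using j0(1) M_Wt by (rule conjI)
      show "j = j0" if "j \<in> {1..r} \<and> cvec ` ?M \<subseteq> Wt j \<inter> cvec ` \<Omega>" for j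
        by (rule M_unique[OF that[THEN conjunct1] that[THEN conjunct2]])
    qed
    show "\<forall>j\<^sub>0\<in>{1..r}. cvec ` ?M \<subseteq> Wt j\<^sub>0 \<inter> cvec ` \<Omega> \<longrightarrow>
       (\<forall>j\<in>{1..r}. j \<noteq> j\<^sub>0 \<and> Wt j \<inter> cvec ` \<Omega> \<noteq> {} \<longrightarrow>
          Wt j \<inter> cvec ` \<Omega> \<subseteq> cvec ` {x. SONC f x \<and> \<not> local_minimizer f x})"
    proof (intro ballI impI subsetI)
      fix j\<^sub>0 j z
      assume "j\<^sub>0 \<in> {1..r}" "cvec ` ?M \<subseteq> Wt j\<^sub>0 \<inter> cvec ` \<Omega>"
        and j: "j \<in> {1..r}" "j \<noteq> j\<^sub>0 \<and> Wt j \<inter> cvec ` \<Omega> \<noteq> {}" and z: "z \<in> Wt j \<inter> cvec ` \<Omega>"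
      then have "j \<noteq> j0" using M_unique by blast
      from z obtain x where x: "z = cvec x" "x \<in> \<Omega>" "cvec x \<in> Wt j" by blast
      then have S: "SONC f x" using SONC_iff j(1) by blast
      have "\<not> local_minimizer f x"
      proof
        assume "local_minimizer f x"
        then have "mp_eval f x = mp_eval f x0" using nospur x0 by simp
        with same[OF j(1) x(3) SONC_norm[OF S] j0 SONC_norm[OF SONC_x0]] \<open>j \<noteq> j0\<close>
        show False by blast
      qed
      with S x(1) show "z \<in> cvec ` {x. SONC f x \<and> \<not> local_minimizer f x}" by blast
    qed
  qed
qed

end
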